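(* Let $\pi/2\le\alpha<\pi$ and $0\le\gamma<1$. Then $$\mathcal{MS}(\alpha)\subset\mathcal{SS}(\gamma)\qquad(|z|\le r_1),$$ where $r_1\in(0,1)$ is the least positive root of the equation $$\arctan\left(\frac{\log\big[N(r,\alpha)\big]}{2\sin\alpha+M_1(r,\alpha)-M_2(r,\alpha)}\right)-\frac{\pi}{2}\gamma=0\qquad(0\le r<1).$$
   Context: $\mathbb{U}=\{z\in\mathbb{C}:|z|<1\}$. $\mathcal{A}$ is the class of functions $f(z)=z+\sum_{n=2}^\infty a_nz^n$ that are analytic and univalent in $\mathbb{U}$. For $\pi/2\le\alpha<\pi$, $\mathcal{MS}(\alpha)$ is the class of all $f\in\mathcal{A}$ such that $$1+\frac{\alpha-\pi}{2\sin\alpha}<\Re\left(\frac{zf'(z)}{f(z)}\right)<1+\frac{\alpha}{2\sin\alpha}\qquad(z\in\mathbb{U}),$$ where $zf'(z)/f(z)$ is given the value $1$ at $z=0$. For $0\le\gamma<1$, $\mathcal{SS}(\gamma)$ is the class of strongly starlike functions of order $\gamma$: $f\in\mathcal{A}$ with $|\arg(zf'(z)/f(z))|\le\frac{\pi}{2}\gamma$ for $z\in\mathbb{U}$ (principal argument). An inclusion "$(|z|\le\rho)$" means that every function of the first class satisfies the defining condition of the second class at all $z$ with $|z|\le\rho$. For $0\le r<1$, $$M_1(r,\alpha)=\arcsin\left(\frac{-r^2\sin2\alpha}{\sqrt{1-2r^2\cos2\alpha+r^4}}\right),\qquad M_2(r,\alpha)=\arcsin\left(\frac{2r\sin\alpha}{\sqrt{1-2r^2\cos2\alpha+r^4}}\right),$$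 $$N(r,\alpha)=\frac{\sqrt{1-2r^2\cos2\alpha+r^4}+2r\sin\alpha}{1-r^2},$$ with $\arcsin$ taking values in $[-\pi/2,\pi/2]$.
   Formalization: The existence of the least positive root r₁ in (0,1) is asserted only for γ > 0; at γ = 0 the equation reads log N(r,α) = 0, but N(r,α) > 1 for 0 < r < 1, so there is no positive root and the claim is vacuous there. *)

theory Defs
  imports "HOL-Complex_Analysis.Complex_Analysis"
begin

definition class_A :: "(complex \<Rightarrow> complex) set" where
  "class_A = {f. f analytic_on ball 0 1 \<and> inj_on f (ball 0 1) \<and>
     (\<exists>a :: nat \<Rightarrow> complex. \<forall>z\<in>ball 0 1. (\<lambda>n. a (n + 2) * z ^ (n + 2)) sums (f z - z))}"

text \<open>The lemma below confirms that the expansion \<open>f z = z + a\<^sub>2 z\<^sup>2 + \<dots>\<close> amounts to the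
  usual normalization.\<close>

lemma class_A_iff:
  "f \<in> class_A \<longleftrightarrow>
     f holomorphic_on ball 0 1 \<and> inj_on f (ball 0 1) \<and> f 0 = 0 \<and> deriv f 0 = 1"
proof -
  have "(\<exists>a :: nat \<Rightarrow> complex. \<forall>z\<in>ball 0 1. (\<lambda>n. a (n + 2) * z ^ (n + 2)) sums (f z - z))
        \<longleftrightarrow> f 0 = 0 \<and> deriv f 0 = 1" (is "?L = ?R") if hol: "f holomorphic_on ball 0 1"
  proof
    assume ?L
    then obtain a :: "nat \<Rightarrow> complex"
      where a: "\<And>z. z \<in> ball 0 1 \<Longrightarrow> (\<lambda>n. a (n + 2) * z ^ (n + 2)) sums (f z - z)" by blast
    define b where "b n = (if n = 0 then 0 else if n = 1 then 1 else a n)" for n :: nat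
    have b: "(\<lambda>n. b n * z ^ n) sums f z" if "z \<in> ball 0 1" for z
    proof -
      have "(\<lambda>n. b (n + 2) * z ^ (n + 2)) sums (f z - (\<Sum>i<2. b i * z ^ i))"
        using a[OF that] by (simp add: b_def numeral_2_eq_2)
      then show ?thesis by (subst (asm) sums_iff_shift') simp
    qed
    have "f 0 = b 0"
      by (rule sums_unique2[OF b[of 0] powser_sums_zero]) simp
    then have "f 0 = 0" by (simp add: b_def)
    moreover have "((\<lambda>z. \<Sum>n. b n * z ^ n) has_field_derivative (\<Sum>n. diffs b n * 0 ^ n)) (at 0)"
      by (rule termdiffs_strong'[where K = 1]) (use b in \<open>auto intro: sums_summable\<close>)
    then have "((\<lambda>z. \<Sum>n. b n * z ^ n) has_field_derivative b 1) (at 0)"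
      by (simp only: powser_zero) (simp add: diffs_def)
    then have "(f has_field_derivative b 1) (at 0)"
      by (rule has_field_derivative_transform_within_open[of _ _ _ "ball 0 1"])
         (use b in \<open>auto intro: sums_unique[symmetric]\<close>)
    then have "deriv f 0 = b 1" by (rule DERIV_imp_deriv)
    ultimately show ?R by (simp add: b_def)
  next
    assume R: ?R
    show ?L
    proof (intro exI ballI)
      fix z :: complex assume z: "z \<in> ball 0 1"
      let ?a = "\<lambda>n. (deriv ^^ n) f 0 / fact n"
      have "(\<lambda>n. ?a n * (z - 0) ^ n) sums f z"
        using holomorphic_power_series[OF hol z] .
      then have "(\<lambda>n. ?a (n + 2) * z ^ (n + 2)) sums (f z - (\<Sum>i<2. ?a i * z ^ i))"
        by (subst sums_iff_shift') simp
      then show "(\<lambda>n. ?a (n + 2) * z ^ (n + 2)) sums (f z - z)"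
        using R by (simp add: numeral_2_eq_2)
    qed
  qed
  then show ?thesis
    by (auto simp: class_A_def analytic_on_open)
qed

definition starlike_quotient :: "(complex \<Rightarrow> complex) \<Rightarrow> complex \<Rightarrow> complex" where
  "starlike_quotient f z = (if z = 0 then 1 else z * deriv f z / f z)"

definition MS :: "real \<Rightarrow> (complex \<Rightarrow> complex) set" where
  "MS \<alpha> = {f \<in> class_A. \<forall>z\<in>ball 0 1.
     1 + (\<alpha> - pi) / (2 * sin \<alpha>) < Re (starlike_quotient f z) \<and>
     Re (starlike_quotient f z) < 1 + \<alpha> / (2 * sin \<alpha>)}"

text \<open>\<open>Arg\<close> is the principal argument in \<open>]-\<pi>, \<pi>]\<close>; its convention \<open>Arg 0 = 0\<close> plays no role,
  since the quotient has no zeros in the disc when \<open>f\<close> is univalent.\<close>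

definition SS_condition :: "real \<Rightarrow> (complex \<Rightarrow> complex) \<Rightarrow> complex \<Rightarrow> bool" where
  "SS_condition \<gamma> f z \<longleftrightarrow> \<bar>Arg (starlike_quotient f z)\<bar> \<le> pi / 2 * \<gamma>"

definition SS :: "real \<Rightarrow> (complex \<Rightarrow> complex) set" where
  "SS \<gamma> = {f \<in> class_A. \<forall>z\<in>ball 0 1. SS_condition \<gamma> f z}"

text \<open>\<open>MS \<alpha> \<subseteq> SS \<gamma>\<close> restricted to \<open>\<bar>z\<bar> \<le> \<rho>\<close>.\<close>

definition MS_included_in_SS_on_disc :: "real \<Rightarrow> real \<Rightarrow> real \<Rightarrow> bool" where
  "MS_included_in_SS_on_disc \<alpha> \<gamma> \<rho> \<longleftrightarrow>
     (\<forall>f\<in>MS \<alpha>. \<forall>z. norm z \<le> \<rho> \<longrightarrow> SS_condition \<gamma> f z)"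

definition M1 :: "real \<Rightarrow> real \<Rightarrow> real" where
  "M1 r \<alpha> = arcsin (- r\<^sup>2 * sin (2 * \<alpha>) / sqrt (1 - 2 * r\<^sup>2 * cos (2 * \<alpha>) + r ^ 4))"

definition M2 :: "real \<Rightarrow> real \<Rightarrow> real" where
  "M2 r \<alpha> = arcsin (2 * r * sin \<alpha> / sqrt (1 - 2 * r\<^sup>2 * cos (2 * \<alpha>) + r ^ 4))"

definition N :: "real \<Rightarrow> real \<Rightarrow> real" where
  "N r \<alpha> = (sqrt (1 - 2 * r\<^sup>2 * cos (2 * \<alpha>) + r ^ 4) + 2 * r * sin \<alpha>) / (1 - r\<^sup>2)"

definition radius_equation :: "real \<Rightarrow> real \<Rightarrow> real \<Rightarrow> bool" where
  "radius_equation \<alpha> \<gamma> r \<longleftrightarrow>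
     arctan (ln (N r \<alpha>) / (2 * sin \<alpha> + M1 r \<alpha> - M2 r \<alpha>)) - pi / 2 * \<gamma> = 0"

definition least_positive_root :: "real \<Rightarrow> real \<Rightarrow> real \<Rightarrow> bool" where
  "least_positive_root \<alpha> \<gamma> r1 \<longleftrightarrow>
     0 < r1 \<and> r1 < 1 \<and> radius_equation \<alpha> \<gamma> r1 \<and>
     (\<forall>r. 0 < r \<and> r < 1 \<and> radius_equation \<alpha> \<gamma> r \<longrightarrow> r1 \<le> r)"

end

theory Submission
  imports Defs
begin

text \<open>
  Write \<open>p = z f' / f\<close>, a holomorphic function on the disc with \<open>p 0 = 1\<close>.  Membership in \<open>MS \<alpha>\<close>
  confines \<open>p\<close> to a vertical strip, and \<open>g = exp (2 \<i> sin \<alpha> (p - 1))\<close> unrolls the strip: its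
  modulus records \<open>Im p\<close>, its argument \<open>\<phi> = 2 sin \<alpha> (Re p - 1)\<close> records \<open>Re p\<close>, and the strip becomes
  the half plane \<open>\<alpha> - \<pi> < \<phi> < \<alpha>\<close>, which consists of the points closer to \<open>1\<close> than to the mirror image
  \<open>e\<^sup>2\<^sup>i\<^sup>\<alpha>\<close> of \<open>1\<close>.  Since \<open>g 0 = 1\<close>, the quotient \<open>(g - 1) / (g - e\<^sup>2\<^sup>i\<^sup>\<alpha>)\<close> is a Schwarz function, and the
  Schwarz lemma gives \<open>\<bar>g - 1\<bar> \<le> r \<bar>g - e\<^sup>2\<^sup>i\<^sup>\<alpha>\<bar>\<close> for \<open>\<bar>z\<bar> \<le> r\<close> (\<open>MS_subordination\<close>).

  This inequality describes a disc of Apollonius, with centre \<open>C / (1 - r\<^sup>2)\<close> for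
  \<open>C = 1 - r\<^sup>2 e\<^sup>2\<^sup>i\<^sup>\<alpha>\<close> and radius \<open>2 r sin \<alpha> / (1 - r\<^sup>2)\<close> (\<open>apollonius_disc\<close>).  The three functions in the
  equation for the radius are geometric data of this disc: \<open>N\<close> is its largest distance from the
  origin and \<open>1 / N\<close> its smallest, \<open>M1\<close> is the argument of its centre, and \<open>M2\<close> is half the angle under
  which it is seen from the origin.  Hence \<open>\<bar>ln \<bar>g\<bar>\<bar> \<le> ln N\<close> and \<open>\<phi> \<ge> M1 - M2\<close>
  (\<open>argument_in_disc_ge\<close>), that is
  \<open>2 sin \<alpha> \<bar>Im p\<bar> \<le> ln N\<close> and \<open>2 sin \<alpha> Re p \<ge> 2 sin \<alpha> + M1 - M2\<close>.  Dividing bounds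
  \<open>\<bar>arctan (Im p / Re p)\<bar>\<close> by the left side of the equation for the radius, so the inclusion holds
  on the disc of radius \<open>r\<close> for every root \<open>r\<close>.

  Dividing requires \<open>2 sin \<alpha> + M1 - M2 > 0\<close> (\<open>denominator_pos\<close>).  The disc stays inside the half plane, so
  \<open>M1 - M2 > \<alpha> - \<pi>\<close>, and \<open>\<pi> - \<alpha> < 2 sin \<alpha>\<close> because \<open>x < 2 sin x\<close> on \<open>(0, \<pi> / 2]\<close>.  The same positivity
  makes the left side of the equation continuous on \<open>[0, 1)\<close>.  It starts at \<open>- \<pi> \<gamma> / 2\<close> and tends to
  \<open>\<pi> / 2 - \<pi> \<gamma> / 2\<close>, because \<open>N\<close> is unbounded as \<open>r\<close> tends to \<open>1\<close>; for \<open>\<gamma> > 0\<close> there is a root, and compactness of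
  the set of roots in a closed interval gives the least one.
\<close>

section \<open>The disc of Apollonius behind \<open>M1\<close>, \<open>M2\<close> and \<open>N\<close>\<close>

text \<open>The centre of the disc scaled by \<open>1 - r\<^sup>2\<close>, which clears the denominators and leaves the radius
  \<open>2 r sin \<alpha>\<close>.\<close>

definition scaled_centre :: "real \<Rightarrow> real \<Rightarrow> complex" where
  "scaled_centre r \<alpha> = 1 - of_real (r\<^sup>2) * cis (2 * \<alpha>)"

lemma norm_scaled_centre_sq_cos:
  "(norm (scaled_centre r \<alpha>))\<^sup>2 = 1 - 2 * r\<^sup>2 * cos (2 * \<alpha>) + r ^ 4"
proof -
  have "(1 - q * C)\<^sup>2 + (q * S)\<^sup>2 = 1 - 2 * q * C + q\<^sup>2 * (C\<^sup>2 + S\<^sup>2)" for q C S :: real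
    by algebra
  from this[of "r\<^sup>2" "cos (2 * \<alpha>)" "sin (2 * \<alpha>)"] show ?thesis
    by (simp add: cmod_power2 scaled_centre_def flip: power_mult)
qed

lemma norm_scaled_centre:
  "norm (scaled_centre r \<alpha>) = sqrt (1 - 2 * r\<^sup>2 * cos (2 * \<alpha>) + r ^ 4)"
  by (metis norm_scaled_centre_sq_cos norm_ge_zero real_sqrt_abs abs_of_nonneg)

text \<open>This form exhibits \<open>(\<bar>C\<bar> - R) (\<bar>C\<bar> + R) = (1 - r\<^sup>2)\<^sup>2\<close> for the scaled radius
  \<open>R = 2 r sin \<alpha>\<close>: the origin lies outside the disc, and after division by \<open>1 - r\<^sup>2\<close> the extreme
  distances from the origin are reciprocal to each other.\<close>

lemma norm_scaled_centre_sq: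
  "(norm (scaled_centre r \<alpha>))\<^sup>2 = (1 - r\<^sup>2)\<^sup>2 + (2 * r * sin \<alpha>)\<^sup>2"
  unfolding norm_scaled_centre_sq_cos cos_double_sin by algebra

text \<open>The arcsine recovers the argument because the scaled centre lies in the closed first quadrant:
  \<open>sin (2 \<alpha>) \<le> 0\<close> in the given range of \<open>\<alpha>\<close>.\<close>

lemma M1_eq_Arg:
  assumes "pi / 2 \<le> \<alpha>" "\<alpha> < pi" "0 \<le> r" "r < 1"
  shows "M1 r \<alpha> = Arg (scaled_centre r \<alpha>)" "0 \<le> M1 r \<alpha>" "M1 r \<alpha> < pi / 2"
proof -
  let ?c = "scaled_centre r \<alpha>"
  have r2: "0 \<le> r\<^sup>2" "r\<^sup>2 < 1" using assms by (auto simp: power_less_one_iff)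
  have Re: "0 < Re ?c"
  proof -
    have "r\<^sup>2 * cos (2 * \<alpha>) \<le> r\<^sup>2 * 1" using r2 by (intro mult_left_mono) auto
    then show ?thesis using r2 by (simp add: scaled_centre_def)
  qed
  have nz: "?c \<noteq> 0" using Re by auto
  have "sin (2 * \<alpha>) \<le> 0"
  proof -
    have "0 \<le> sin \<alpha>" "cos \<alpha> \<le> 0"
      using assms pi_gt_zero cos_monotone_0_pi_le[of "pi/2" \<alpha>] by (auto intro!: sin_ge_zero)
    then show ?thesis by (simp add: sin_double mult_nonneg_nonpos)
  qed
  then have Im: "0 \<le> Im ?c" using r2 by (simp add: scaled_centre_def mult_nonneg_nonpos)
  have arg: "Arg ?c = arctan (Im ?c / Re ?c)" using Re by (rule arg_conv_arctan)
  have lo: "0 \<le> Arg ?c" using Re Im arg by simp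
  have hi: "Arg ?c < pi / 2" using arg arctan_bounded by simp
  have "M1 r \<alpha> = arcsin (Im ?c / norm ?c)"
    unfolding M1_def norm_scaled_centre by (simp add: scaled_centre_def)
  also have "\<dots> = arcsin (sin (Arg ?c))" using nz by (simp add: sin_Arg)
  also have "\<dots> = Arg ?c" using lo hi by (intro arcsin_sin) auto
  finally show M1: "M1 r \<alpha> = Arg ?c" .
  show "0 \<le> M1 r \<alpha>" "M1 r \<alpha> < pi / 2" using lo hi M1 by simp_all
qed

lemma norm_scaled_centre_gt:
  assumes "0 < sin \<alpha>" "0 \<le> r" "r < 1"
  shows "2 * r * sin \<alpha> < norm (scaled_centre r \<alpha>)"
proof (rule power2_less_imp_less)
  have "r\<^sup>2 < 1" using assms by (simp add: power_less_one_iff)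
  then have "0 < (1 - r\<^sup>2)\<^sup>2" by simp
  then show "(2 * r * sin \<alpha>)\<^sup>2 < (norm (scaled_centre r \<alpha>))\<^sup>2"
    unfolding norm_scaled_centre_sq by linarith
qed simp

lemma sin_M2:
  assumes "0 < sin \<alpha>" "0 \<le> r" "r < 1"
  shows "sin (M2 r \<alpha>) = 2 * r * sin \<alpha> / norm (scaled_centre r \<alpha>)"
    "0 \<le> M2 r \<alpha>" "M2 r \<alpha> < pi / 2"
proof -
  let ?n = "norm (scaled_centre r \<alpha>)"
  have less: "2 * r * sin \<alpha> < ?n" by (rule norm_scaled_centre_gt[OF assms])
  have nn: "0 \<le> 2 * r * sin \<alpha>" using assms by simp
  have b: "0 \<le> 2 * r * sin \<alpha> / ?n" "2 * r * sin \<alpha> / ?n < 1"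
    using less nn by (auto simp: divide_less_eq)
  have M2: "M2 r \<alpha> = arcsin (2 * r * sin \<alpha> / ?n)"
    by (simp add: M2_def norm_scaled_centre)
  show "sin (M2 r \<alpha>) = 2 * r * sin \<alpha> / ?n" unfolding M2 using b by (intro sin_arcsin) auto
  show "0 \<le> M2 r \<alpha>" unfolding M2 using b arcsin_le_arcsin[of 0 "2 * r * sin \<alpha> / ?n"] by simp
  show "M2 r \<alpha> < pi / 2" unfolding M2 using b arcsin_lt_bounded[of "2 * r * sin \<alpha> / ?n"] by simp
qed

text \<open>The disc does not reach the boundary line \<open>arg = \<alpha> - \<pi>\<close> of the half plane: the distance of the
  scaled centre from that line is \<open>\<bar>C\<bar> sin (M1 + \<pi> - \<alpha>) = (1 + r\<^sup>2) sin \<alpha>\<close>, which exceeds the radius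
  \<open>2 r sin \<alpha>\<close> by \<open>(1 - r)\<^sup>2 sin \<alpha>\<close>.\<close>

lemma M2_minus_M1_less:
  assumes "pi / 2 \<le> \<alpha>" "\<alpha> < pi" "0 \<le> r" "r < 1"
  shows "M2 r \<alpha> - M1 r \<alpha> < pi - \<alpha>"
proof (cases "M1 r \<alpha> + (pi - \<alpha>) \<le> pi / 2")
  case True
  let ?c = "scaled_centre r \<alpha>"
  have s: "0 < sin \<alpha>" using assms pi_gt_zero by (intro sin_gt_zero) linarith+
  note M1 = M1_eq_Arg[OF assms] and M2 = sin_M2[OF s assms(3,4)]
  have n: "0 < norm ?c" using norm_scaled_centre_gt[OF s assms(3,4)] s assms by (smt (verit) mult_nonneg_nonneg)
  have "sin (M1 r \<alpha> + (pi - \<alpha>)) * norm ?c = sin (\<alpha> - M1 r \<alpha>) * norm ?c"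
    by (metis add_diff_eq add.commute diff_diff_eq2 sin_pi_minus)
  also have "\<dots> = sin \<alpha> * Re ?c - cos \<alpha> * Im ?c"
    using n unfolding sin_diff M1(1) by (simp add: cos_Arg sin_Arg field_simps)
  also have "\<dots> = sin \<alpha> + r\<^sup>2 * sin (2 * \<alpha> - \<alpha>)"
    unfolding sin_diff[of "2 * \<alpha>"] by (simp add: scaled_centre_def algebra_simps)
  finally have eq: "sin (M1 r \<alpha> + (pi - \<alpha>)) * norm ?c = sin \<alpha> * (1 + r\<^sup>2)"
    by (simp add: algebra_simps)
  have "0 < (1 - r)\<^sup>2" using assms by simp
  then have "2 * r < 1 + r\<^sup>2" by (simp add: power2_eq_square algebra_simps)
  then have "sin \<alpha> * (2 * r) < sin \<alpha> * (1 + r\<^sup>2)" using s by (intro mult_strict_left_mono)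
  then have "sin (M2 r \<alpha>) < sin (M1 r \<alpha> + (pi - \<alpha>))"
    using n unfolding M2(1) eq[symmetric] by (simp add: divide_less_eq mult_ac)
  then have "M2 r \<alpha> < M1 r \<alpha> + (pi - \<alpha>)"
    using True M1 M2 assms by (subst (asm) sin_mono_less_eq) auto
  then show ?thesis by simp
next
  case False
  have s: "0 < sin \<alpha>" using assms pi_gt_zero by (intro sin_gt_zero) linarith+
  then show ?thesis using False sin_M2(3)[OF s assms(3,4)] by linarith
qed

text \<open>With \<open>x = \<pi> - \<alpha>\<close>, the inequality \<open>x / 2 \<le> tan (x / 2)\<close> multiplied by \<open>4 cos\<^sup>2 (x / 2)\<close> becomes
  \<open>x (1 + cos x) \<le> 2 sin x\<close>.  This is strong enough unless \<open>cos x = 0\<close>, where the claim is \<open>\<pi> < 4\<close>.\<close>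

lemma pi_minus_less_two_sin:
  fixes \<alpha> :: real
  assumes "pi / 2 \<le> \<alpha>" "\<alpha> < pi"
  shows "pi - \<alpha> < 2 * sin \<alpha>"
proof -
  define x where "x = pi - \<alpha>"
  have x: "0 < x" "x \<le> pi / 2" using assms by (auto simp: x_def)
  have sin: "sin \<alpha> = sin x" by (simp add: x_def)
  have cos_half: "0 < cos (x / 2)" using x by (intro cos_gt_zero) auto
  have "x / 2 \<le> tan (x / 2)"
    using abs_tan_ge[of "x / 2"] tan_gt_zero[of "x / 2"] x by simp
  then have "x / 2 * cos (x / 2) \<le> sin (x / 2)"
    using cos_half by (simp add: tan_def le_divide_eq)
  then have "4 * (x / 2 * cos (x / 2) * cos (x / 2)) \<le> 4 * (sin (x / 2) * cos (x / 2))"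
    using cos_half by (intro mult_left_mono mult_right_mono) auto
  also have "\<dots> = 2 * sin x" using sin_double[of "x / 2"] by simp
  also have "4 * (x / 2 * cos (x / 2) * cos (x / 2)) = x * (1 + cos x)"
    using cos_double_cos[of "x / 2"] by (simp add: power2_eq_square algebra_simps)
  finally have le: "x * (1 + cos x) \<le> 2 * sin x" .
  have "x < 2 * sin x"
  proof (cases "x = pi / 2")
    case True
    then have "sin x = 1" by (simp only: sin_pi_half)
    then show ?thesis using True pi_less_4 by linarith
  next
    case False
    then have "0 < x * cos x" using x by (intro mult_pos_pos cos_gt_zero) auto
    then show ?thesis using le by (simp add: distrib_left)
  qed
  then show ?thesis unfolding sin x_def .
qed

lemma denominator_pos:
  assumes "pi / 2 \<le> \<alpha>" "\<alpha> < pi" "0 \<le> r" "r < 1"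
  shows "0 < 2 * sin \<alpha> + M1 r \<alpha> - M2 r \<alpha>"
  using M2_minus_M1_less[OF assms] pi_minus_less_two_sin[OF assms(1,2)] by linarith

section \<open>Existence of the least root\<close>

text \<open>Intermediate value theorem on an interval \<open>[0, b]\<close> with \<open>b\<close> close to \<open>1\<close>, then the minimum of the
  compact set of roots in \<open>[0, b]\<close>.\<close>

lemma exists_least_positive_root:
  assumes "pi / 2 \<le> \<alpha>" "\<alpha> < pi" "0 < \<gamma>" "\<gamma> < 1"
  shows "\<exists>r1. least_positive_root \<alpha> \<gamma> r1"
proof -
  define D where "D r = 2 * sin \<alpha> + M1 r \<alpha> - M2 r \<alpha>" for r
  define F where "F r = arctan (ln (N r \<alpha>) / D r)" for r
  define y where "y = pi / 2 * \<gamma>"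
  have y: "0 < y" "y < pi / 2" using assms by (auto simp: y_def)
  have s: "0 < sin \<alpha>" using assms pi_gt_zero by (intro sin_gt_zero) linarith+
  have D: "0 < D r" if "0 \<le> r" "r < 1" for r
    using denominator_pos[OF assms(1,2) that] by (simp add: D_def)
  have n_pos: "0 < norm (scaled_centre r \<alpha>)" if "0 \<le> r" "r < 1" for r
    using norm_scaled_centre_gt[OF s that] s that by (smt (verit) mult_nonneg_nonneg)
  have N: "N r \<alpha> = (norm (scaled_centre r \<alpha>) + 2 * r * sin \<alpha>) / (1 - r\<^sup>2)" for r
    by (simp add: N_def norm_scaled_centre)
  have r2: "r\<^sup>2 < 1" if "0 \<le> r" "r < 1" for r :: real
    using that by (simp add: power_less_one_iff)
  have contF: "continuous_on {0..b} F" if "b < 1" for b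
  proof -
    have r1: "0 \<le> r" "r < 1" if "r \<in> {0..b}" for r using that \<open>b < 1\<close> by auto
    have contc: "continuous_on {0..b} (\<lambda>r. scaled_centre r \<alpha>)"
      unfolding scaled_centre_def by (intro continuous_intros)
    have M1: "M1 = (\<lambda>r \<alpha>. arcsin (Im (scaled_centre r \<alpha>) / norm (scaled_centre r \<alpha>)))"
      unfolding M1_def norm_scaled_centre by (intro ext) (simp add: scaled_centre_def)
    have M2: "M2 = (\<lambda>r \<alpha>. arcsin (2 * r * sin \<alpha> / norm (scaled_centre r \<alpha>)))"
      by (intro ext) (simp add: M2_def norm_scaled_centre)
    have contM1: "continuous_on {0..b} (\<lambda>r. M1 r \<alpha>)"
      unfolding M1
    proof (intro continuous_intros contc ballI)
      fix r assume r: "r \<in> {0..b}"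
      show "norm (scaled_centre r \<alpha>) \<noteq> 0" using n_pos[OF r1[OF r]] by simp
      have "\<bar>Im (scaled_centre r \<alpha>) / norm (scaled_centre r \<alpha>)\<bar> \<le> 1"
        using n_pos[OF r1[OF r]] abs_Im_le_cmod by (simp add: divide_le_eq)
      then show "- 1 \<le> Im (scaled_centre r \<alpha>) / norm (scaled_centre r \<alpha>) \<and>
         Im (scaled_centre r \<alpha>) / norm (scaled_centre r \<alpha>) \<le> 1" by linarith
    qed
    have contM2: "continuous_on {0..b} (\<lambda>r. M2 r \<alpha>)"
      unfolding M2
    proof (intro continuous_intros contc ballI)
      fix r assume r: "r \<in> {0..b}"
      show "norm (scaled_centre r \<alpha>) \<noteq> 0" using n_pos[OF r1[OF r]] by simp
      have "0 \<le> 2 * r * sin \<alpha> / norm (scaled_centre r \<alpha>)" using r1[OF r] s by simp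
      moreover have "2 * r * sin \<alpha> / norm (scaled_centre r \<alpha>) \<le> 1"
        using n_pos[OF r1[OF r]] norm_scaled_centre_gt[OF s r1[OF r]] by (simp add: divide_le_eq)
      ultimately show "- 1 \<le> 2 * r * sin \<alpha> / norm (scaled_centre r \<alpha>) \<and>
         2 * r * sin \<alpha> / norm (scaled_centre r \<alpha>) \<le> 1" by linarith
    qed
    have contN: "continuous_on {0..b} (\<lambda>r. N r \<alpha>)"
      unfolding N
    proof (intro continuous_intros contc ballI)
      fix r assume "r \<in> {0..b}"
      then show "1 - r\<^sup>2 \<noteq> 0" using r2[of r] r1[of r] by simp
    qed
    have Npos: "N r \<alpha> \<noteq> 0" if "r \<in> {0..b}" for r
    proof -
      have "0 < N r \<alpha>" unfolding N using n_pos r1[OF that] s r2[of r]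
        by (intro divide_pos_pos add_pos_nonneg) auto
      then show ?thesis by simp
    qed
    have contD: "continuous_on {0..b} D"
      unfolding D_def by (intro continuous_intros contM1 contM2)
    show ?thesis unfolding F_def
    proof (intro continuous_intros contN contD ballI)
      fix r assume r: "r \<in> {0..b}"
      show "N r \<alpha> \<noteq> 0" by (rule Npos[OF r])
      show "D r \<noteq> 0" using D[OF r1[OF r]] by simp
    qed
  qed
  obtain b where b: "0 \<le> b" "b < 1" "y < F b"
  proof -
    \<comment> \<open>\<open>2 sin \<alpha> + \<pi> / 2\<close> bounds \<open>D\<close>, so \<open>ln (N b \<alpha>) / D b > tan y\<close> as soon as \<open>N b \<alpha> > E\<close>.  As
      \<open>N b \<alpha>\<close> is at least \<open>2 b sin \<alpha> / (1 - b\<^sup>2)\<close>, a gap \<open>e = 1 - b\<close> of at most \<open>sin \<alpha> / (4 E)\<close> suffices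
      once \<open>b \<ge> 1 / 2\<close>.\<close>
    define E where "E = exp (tan y * (2 * sin \<alpha> + pi / 2))"
    define e where "e = min (1 / 2) (sin \<alpha> / (4 * E))"
    have E: "0 < E" by (simp add: E_def)
    have e: "0 < e" "e \<le> 1 / 2" "e * (4 * E) \<le> sin \<alpha>"
    proof -
      show "0 < e" "e \<le> 1 / 2" using s E by (simp_all add: e_def)
      have "e * (4 * E) \<le> sin \<alpha> / (4 * E) * (4 * E)"
        using E by (intro mult_right_mono) (simp_all add: e_def)
      then show "e * (4 * E) \<le> sin \<alpha>" using E by simp
    qed
    define b where "b = 1 - e"
    have b: "0 \<le> b" "b < 1" using e by (auto simp: b_def)
    have b2: "0 < 1 - b\<^sup>2" using r2[OF b] by simp
    have "E * (1 - b\<^sup>2) = E * (e * (2 - e))" by (simp add: b_def power2_eq_square algebra_simps)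
    also have "\<dots> \<le> E * (e * 2)" using E e by (intro mult_left_mono) auto
    also have "\<dots> < e * (4 * E)" using e E by simp
    also have "\<dots> \<le> sin \<alpha>" by (rule e)
    also have "\<dots> \<le> 2 * b * sin \<alpha>" using s e by (simp add: b_def)
    also have "\<dots> \<le> norm (scaled_centre b \<alpha>) + 2 * b * sin \<alpha>" by simp
    finally have "E < N b \<alpha>" unfolding N using b2 by (simp add: less_divide_eq)
    then have "ln E < ln (N b \<alpha>)" using E by (subst ln_less_cancel_iff) auto
    moreover have "ln E = tan y * (2 * sin \<alpha> + pi / 2)" by (simp add: E_def)
    moreover have "tan y * D b \<le> tan y * (2 * sin \<alpha> + pi / 2)"
    proof (rule mult_left_mono)
      show "D b \<le> 2 * sin \<alpha> + pi / 2"
        using M1_eq_Arg(3)[OF assms(1,2) b] sin_M2(2)[OF s b] by (simp add: D_def)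
      show "0 \<le> tan y" using y by (simp add: tan_gt_zero less_imp_le)
    qed
    ultimately have "tan y < ln (N b \<alpha>) / D b"
      using D[OF b] by (simp add: less_divide_eq)
    then have "arctan (tan y) < F b" unfolding F_def by (rule arctan_monotone)
    moreover have "arctan (tan y) = y" using y by (intro arctan_tan) auto
    ultimately show thesis using that b by simp
  qed
  have F0: "F 0 = 0" by (simp add: F_def N scaled_centre_def)
  define S where "S = {r \<in> {0..b}. F r = y}"
  have "\<exists>r\<ge>0. r \<le> b \<and> F r = y"
    using IVT'[of F 0 y b] F0 y b contF by auto
  then have "S \<noteq> {}" by (auto simp: S_def)
  moreover have "compact S"
  proof -
    have "closed S" unfolding S_def
      by (intro continuous_closed_preimage_constant contF b closed_atLeastAtMost)
    moreover have "bounded S" by (rule bounded_subset[of "{0..b}"]) (auto simp: S_def)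
    ultimately show ?thesis by (simp add: compact_eq_bounded_closed)
  qed
  ultimately obtain r1 where r1: "r1 \<in> S" "\<And>t. t \<in> S \<Longrightarrow> r1 \<le> t"
    using compact_attains_inf[of S] by blast
  have req: "radius_equation \<alpha> \<gamma> r \<longleftrightarrow> F r = y" for r
    unfolding radius_equation_def F_def D_def y_def by linarith
  have "r1 \<noteq> 0" using r1(1) F0 y(1) unfolding S_def by force
  then have "0 < r1" "r1 < 1" "radius_equation \<alpha> \<gamma> r1"
    using r1(1) b by (simp_all add: S_def req)
  moreover have "r1 \<le> r" if "0 < r" "r < 1" "radius_equation \<alpha> \<gamma> r" for r
  proof (cases "r \<le> b")
    case True
    then show ?thesis using that by (intro r1(2)) (simp add: S_def req)
  next
    case False
    then show ?thesis using r1(1) by (simp add: S_def)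
  qed
  ultimately show ?thesis unfolding least_positive_root_def by blast
qed

section \<open>Geometry of the half plane and of the disc\<close>

text \<open>The points \<open>1\<close> and \<open>e\<^sup>2\<^sup>i\<^sup>\<alpha>\<close> are mirror images in the line through the origin with direction
  \<open>e\<^sup>i\<^sup>\<alpha>\<close>, so the difference is a multiple of the signed distance of \<open>g\<close> from that line.  Its sign
  decides which of the two points is closer.\<close>

lemma sq_distance_difference_double_angle:
  assumes "g = rcis t \<phi>"
  shows "(norm (g - 1))\<^sup>2 - (norm (g - cis (2 * \<alpha>)))\<^sup>2 = 4 * sin \<alpha> * (t * sin (\<phi> - \<alpha>))"
proof -
  have "(x - 1)\<^sup>2 + y\<^sup>2 - ((x - (1 - 2 * s\<^sup>2))\<^sup>2 + (y - 2 * s * c)\<^sup>2) = 4 * s * (y * c - x * s)"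
    if "s\<^sup>2 + c\<^sup>2 = 1" for x y s c :: real
    using that by algebra
  from this[OF sin_cos_squared_add[of \<alpha>], of "Re g" "Im g"]
  have "(norm (g - 1))\<^sup>2 - (norm (g - cis (2 * \<alpha>)))\<^sup>2
      = 4 * sin \<alpha> * (Im g * cos \<alpha> - Re g * sin \<alpha>)"
    unfolding cmod_power2 by (simp add: cos_double_sin sin_double)
  then show ?thesis by (simp add: assms sin_diff algebra_simps)
qed

text \<open>Completing the square turns the inequality between the squared distances into that of a disc.
  The constant left over is \<open>r\<^sup>2 \<bar>1 - e\<^sup>2\<^sup>i\<^sup>\<alpha>\<bar>\<^sup>2 = (2 r sin \<alpha>)\<^sup>2\<close>, the square of the scaled radius.\<close>

lemma apollonius_disc:
  assumes "norm (g - 1) \<le> r * norm (g - cis (2 * \<alpha>))" "0 \<le> r" "r < 1" "0 \<le> sin \<alpha>"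
  shows "norm (of_real (1 - r\<^sup>2) * g - scaled_centre r \<alpha>) \<le> 2 * r * sin \<alpha>"
proof (rule power2_le_imp_le)
  have r2: "r\<^sup>2 < 1" using assms by (simp add: power_less_one_iff)
  have "((1 - q) * x - (1 - q * C))\<^sup>2 + ((1 - q) * y + q * S)\<^sup>2
      = (1 - q) * (((x - 1)\<^sup>2 + y\<^sup>2) - q * ((x - C)\<^sup>2 + (y - S)\<^sup>2)) + q * (2 - 2 * C)"
    if "S\<^sup>2 + C\<^sup>2 = 1" for q x y C S :: real
    using that by algebra
  from this[OF sin_cos_squared_add[of "2 * \<alpha>"], of "r\<^sup>2" "Re g" "Im g"]
  have "(norm (of_real (1 - r\<^sup>2) * g - scaled_centre r \<alpha>))\<^sup>2
     = (1 - r\<^sup>2) * ((norm (g - 1))\<^sup>2 - (r * norm (g - cis (2 * \<alpha>)))\<^sup>2) + r\<^sup>2 * (2 - 2 * cos (2 * \<alpha>))"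
    unfolding power_mult_distrib cmod_power2 scaled_centre_def by simp
  also have "(2 - 2 * cos (2 * \<alpha>)) = (2 * sin \<alpha>)\<^sup>2" by (simp add: cos_double_sin)
  also have "(1 - r\<^sup>2) * ((norm (g - 1))\<^sup>2 - (r * norm (g - cis (2 * \<alpha>)))\<^sup>2) \<le> 0"
    using r2 power_mono[OF assms(1), of 2] by (intro mult_nonneg_nonpos) auto
  finally show "(norm (of_real (1 - r\<^sup>2) * g - scaled_centre r \<alpha>))\<^sup>2 \<le> (2 * r * sin \<alpha>)\<^sup>2"
    by (simp add: power_mult_distrib)
  show "0 \<le> 2 * r * sin \<alpha>" using assms by simp
qed

text \<open>A disc of radius \<open>\<bar>c\<bar> sin \<beta>\<close> about \<open>c\<close> touches the two rays at angle \<open>\<beta>\<close> from the direction of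
  \<open>c\<close>: by the law of cosines, a point at angular distance \<open>\<delta>\<close> from \<open>c\<close> with \<open>cos \<delta> < cos \<beta>\<close> is too far
  away.  The hypothesis \<open>Arg c - \<phi> < \<pi>\<close> excludes representatives \<open>\<phi>\<close> of the argument that are off by
  a full turn.\<close>

lemma argument_in_disc_ge:
  assumes near: "norm (rcis t \<phi> - c) \<le> norm c * sin \<beta>" and "c \<noteq> 0" "0 < t"
    and \<beta>: "0 \<le> \<beta>" "\<beta> < pi / 2" and "Arg c - \<phi> < pi"
  shows "Arg c - \<beta> \<le> \<phi>"
proof (rule ccontr)
  define \<delta> where "\<delta> = Arg c - \<phi>"
  assume "\<not> ?thesis"
  then have \<delta>: "\<beta> < \<delta>" "\<delta> < pi" using assms by (auto simp: \<delta>_def)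
  then have cos: "cos \<delta> < cos \<beta>" using \<beta> by (intro cos_monotone_0_pi) auto
  let ?n = "norm c"
  have n: "0 < ?n" using assms by simp
  have c: "c = rcis ?n (Arg c)" by (simp add: rcis_cmod_Arg)
  have "(t * x - n * X)\<^sup>2 + (t * y - n * Y)\<^sup>2 = t\<^sup>2 - 2 * t * n * (X * x + Y * y) + n\<^sup>2"
    if "y\<^sup>2 + x\<^sup>2 = 1" "Y\<^sup>2 + X\<^sup>2 = 1" for n x y X Y :: real
    using that by algebra
  from this[OF sin_cos_squared_add sin_cos_squared_add]
  have "(norm (rcis t \<phi> - rcis n \<psi>))\<^sup>2 = t\<^sup>2 - 2 * t * n * cos (\<psi> - \<phi>) + n\<^sup>2" for n \<psi>
    unfolding cmod_power2 cos_diff by simp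
  then have "t\<^sup>2 - 2 * t * ?n * cos \<delta> + ?n\<^sup>2 = (norm (rcis t \<phi> - c))\<^sup>2"
    using c unfolding \<delta>_def by metis
  also have "\<dots> \<le> (?n * sin \<beta>)\<^sup>2" using near by (intro power_mono) auto
  also have "\<dots> = ?n\<^sup>2 - (?n * cos \<beta>)\<^sup>2" by (simp add: power_mult_distrib sin_squared_eq algebra_simps)
  finally have "(t - ?n * cos \<beta>)\<^sup>2 + 2 * t * ?n * (cos \<beta> - cos \<delta>) \<le> 0"
    by (simp add: power2_eq_square algebra_simps)
  moreover have "0 < 2 * t * ?n * (cos \<beta> - cos \<delta>)" using cos n assms by simp
  moreover have "0 \<le> (t - ?n * cos \<beta>)\<^sup>2" by simp
  ultimately show False by linarith
qed

section \<open>Functions in \<open>MS \<alpha>\<close>\<close>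

text \<open>The singularity at \<open>0\<close> is removable: \<open>h z = f z / z\<close> extends holomorphically by \<open>h 0 = f' 0 = 1\<close>,
  univalence keeps \<open>h\<close> free of zeros, and the quotient is \<open>f' / h\<close>.\<close>

lemma starlike_quotient_holomorphic:
  assumes "f \<in> class_A"
  shows "starlike_quotient f holomorphic_on ball 0 1"
proof -
  have f: "f holomorphic_on ball 0 1" "inj_on f (ball 0 1)" "f 0 = 0" "deriv f 0 = 1"
    using assms by (auto simp: class_A_iff)
  define h where "h z = (if z = 0 then deriv f 0 else f z / z)" for z
  have h: "h holomorphic_on ball 0 1"
    using f(1) by (rule pole_theorem_open_0[where a = 0]) (auto simp: h_def f(3))
  have hnz: "h z \<noteq> 0" if "z \<in> ball 0 1" for z
    using that f(2,3,4) by (auto simp: h_def dest: inj_onD[of f _ z 0])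
  have "(\<lambda>z. deriv f z / h z) holomorphic_on ball 0 1"
    using f(1) h hnz by (intro holomorphic_intros) auto
  then show ?thesis
    by (rule holomorphic_transform) (auto simp: starlike_quotient_def h_def f(4))
qed

text \<open>The analytic core: the Schwarz lemma, applied to \<open>w = (g - 1) / (g - e\<^sup>2\<^sup>i\<^sup>\<alpha>)\<close>.\<close>

lemma MS_subordination:
  assumes "pi / 2 \<le> \<alpha>" "\<alpha> < pi" and f: "f \<in> MS \<alpha>" and z: "norm z < 1"
  defines "g \<equiv> exp (2 * \<i> * of_real (sin \<alpha>) * (starlike_quotient f z - 1))"
  shows "norm (g - 1) \<le> norm z * norm (g - cis (2 * \<alpha>))"
proof -
  define G where "G z = exp (2 * \<i> * of_real (sin \<alpha>) * (starlike_quotient f z - 1))" for z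
  define w where "w z = (G z - 1) / (G z - cis (2 * \<alpha>))" for z
  have s: "0 < sin \<alpha>" using assms pi_gt_zero by (intro sin_gt_zero) linarith+
  have A: "f \<in> class_A" using f by (simp add: MS_def)
  have closer: "norm (G z - 1) < norm (G z - cis (2 * \<alpha>))" if "norm z < 1" for z
  proof (rule power2_less_imp_less)
    define p where "p = starlike_quotient f z"
    define \<phi> where "\<phi> = 2 * sin \<alpha> * (Re p - 1)"
    have "1 + (\<alpha> - pi) / (2 * sin \<alpha>) < Re p" "Re p < 1 + \<alpha> / (2 * sin \<alpha>)"
      using f that by (auto simp: MS_def p_def)
    then have "- pi < \<phi> - \<alpha>" "\<phi> - \<alpha> < 0"
      using s by (simp_all add: \<phi>_def field_simps)
    then have "0 < sin (- (\<phi> - \<alpha>))" by (intro sin_gt_zero) auto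
    then have sn: "sin (\<phi> - \<alpha>) < 0" by (simp only: sin_minus)
    have G: "G z = rcis (exp (- 2 * sin \<alpha> * Im p)) \<phi>"
      by (simp add: G_def p_def \<phi>_def rcis_def exp_eq_polar)
    have "sin \<alpha> * (exp (- 2 * sin \<alpha> * Im p) * sin (\<phi> - \<alpha>)) < 0"
      using s sn by (intro mult_pos_neg) auto
    then show "(norm (G z - 1))\<^sup>2 < (norm (G z - cis (2 * \<alpha>)))\<^sup>2"
      using sq_distance_difference_double_angle[OF G, of \<alpha>] by simp
  qed simp
  then have nz: "G z \<noteq> cis (2 * \<alpha>)" if "norm z < 1" for z using that by force
  have "w holomorphic_on ball 0 1"
    unfolding w_def G_def using nz starlike_quotient_holomorphic[OF A]
    by (intro holomorphic_intros) (auto simp: G_def)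
  moreover have "w 0 = 0" by (simp add: w_def G_def starlike_quotient_def)
  moreover have "norm (w z) < 1" if "norm z < 1" for z
    using closer[OF that] nz[OF that] by (simp add: w_def norm_divide)
  ultimately have "norm (w z) \<le> norm z" using z by (rule Schwarz_Lemma(1))
  then show ?thesis using nz[OF z] by (simp add: w_def G_def g_def norm_divide divide_le_eq)
qed

text \<open>Modulus and argument of \<open>g\<close> are bounded on the disc of Apollonius and translated back into
  bounds on \<open>Im p\<close> and \<open>Re p\<close>.\<close>

lemma MS_included_of_root:
  assumes "pi / 2 \<le> \<alpha>" "\<alpha> < pi" "0 < r" "r < 1" and root: "radius_equation \<alpha> \<gamma> r"
  shows "MS_included_in_SS_on_disc \<alpha> \<gamma> r"
  unfolding MS_included_in_SS_on_disc_def
proof (intro ballI allI impI)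
  fix f and z :: complex assume f: "f \<in> MS \<alpha>" and z: "norm z \<le> r"
  let ?s = "sin \<alpha>" and ?c = "scaled_centre r \<alpha>"
  have s: "0 < ?s" using assms pi_gt_zero by (intro sin_gt_zero) linarith+
  have r: "0 \<le> r" "r < 1" using assms by auto
  have r2: "0 < 1 - r\<^sup>2" using r by (simp add: power_less_one_iff)
  define p where "p = starlike_quotient f z"
  define \<phi> where "\<phi> = 2 * ?s * (Re p - 1)"
  define t where "t = exp (- 2 * ?s * Im p)"
  define g where "g = exp (2 * \<i> * of_real ?s * (p - 1))"
  have t: "0 < t" by (simp add: t_def)
  have g: "g = rcis t \<phi>" by (simp add: g_def t_def \<phi>_def rcis_def exp_eq_polar)
  have normz: "norm z < 1" using z r by simp
  have "norm (g - 1) \<le> norm z * norm (g - cis (2 * \<alpha>))"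
    using MS_subordination[OF assms(1,2) f normz] by (simp add: g_def p_def)
  also have "\<dots> \<le> r * norm (g - cis (2 * \<alpha>))" using z by (intro mult_right_mono) auto
  finally have near: "norm (of_real (1 - r\<^sup>2) * g - ?c) \<le> 2 * r * ?s"
    using r s by (intro apollonius_disc) auto
  have c_gt: "2 * r * ?s < norm ?c" by (rule norm_scaled_centre_gt[OF s r])
  have c: "0 < norm ?c" using c_gt r s by (smt (verit) mult_nonneg_nonneg)
  have N: "N r \<alpha> = (norm ?c + 2 * r * ?s) / (1 - r\<^sup>2)" by (simp add: N_def norm_scaled_centre)
  have Npos: "0 < N r \<alpha>" unfolding N using c r s r2 by (intro divide_pos_pos add_pos_nonneg) auto
  have ng: "norm (of_real (1 - r\<^sup>2) * g) = (1 - r\<^sup>2) * t"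
    using r2 t unfolding norm_mult norm_of_real g by simp
  have "(1 - r\<^sup>2) * t \<le> norm ?c + 2 * r * ?s"
    using near norm_triangle_ineq2[of "of_real (1 - r\<^sup>2) * g" ?c] ng by linarith
  then have t_le: "t \<le> N r \<alpha>" using r2 by (simp add: N le_divide_eq mult_ac)
  \<comment> \<open>The lower bound \<open>t \<ge> 1 / N\<close> comes from \<open>(\<bar>C\<bar> - R) (\<bar>C\<bar> + R) = (1 - r\<^sup>2)\<^sup>2\<close>.\<close>
  have "norm ?c - 2 * r * ?s \<le> (1 - r\<^sup>2) * t"
    using near norm_triangle_ineq3[of "of_real (1 - r\<^sup>2) * g" ?c] ng by linarith
  then have "(norm ?c - 2 * r * ?s) * (norm ?c + 2 * r * ?s) \<le> (1 - r\<^sup>2) * t * (norm ?c + 2 * r * ?s)"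
    using c r s by (intro mult_right_mono) auto
  also have "(norm ?c - 2 * r * ?s) * (norm ?c + 2 * r * ?s) = (1 - r\<^sup>2)\<^sup>2"
    using norm_scaled_centre_sq[of r \<alpha>] by (simp add: power2_eq_square algebra_simps)
  finally have "1 - r\<^sup>2 \<le> t * (norm ?c + 2 * r * ?s)"
    using r2 by (simp add: power2_eq_square mult.assoc)
  then have t_ge: "1 \<le> t * N r \<alpha>" using r2 by (simp add: N le_divide_eq)
  have "ln t \<le> ln (N r \<alpha>)" using t_le t Npos by simp
  moreover have "- ln (N r \<alpha>) \<le> ln t"
    using t_ge t Npos ln_mult[of t "N r \<alpha>"] ln_ge_zero[of "t * N r \<alpha>"] by simp
  moreover have "ln t = - (2 * ?s * Im p)" by (simp add: t_def)
  ultimately have Im: "2 * ?s * \<bar>Im p\<bar> \<le> ln (N r \<alpha>)" using s by (simp add: abs_if)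
  note M1 = M1_eq_Arg[OF assms(1,2) r] and M2 = sin_M2[OF s r]
  \<comment> \<open>The strip condition bounds \<open>\<phi>\<close> below by \<open>\<alpha> - \<pi>\<close>, so \<open>Arg C - \<phi> < \<pi> / 2 + \<pi> - \<alpha> \<le> \<pi>\<close>.\<close>
  have "1 + (\<alpha> - pi) / (2 * ?s) < Re p" using f normz by (auto simp: MS_def p_def)
  then have "\<alpha> - pi < \<phi>" using s by (simp add: \<phi>_def field_simps)
  then have "Arg ?c - \<phi> < pi" using M1 assms by linarith
  moreover have "norm (rcis ((1 - r\<^sup>2) * t) \<phi> - ?c) \<le> norm ?c * sin (M2 r \<alpha>)"
    using near c unfolding M2(1) g by (simp add: rcis_def mult.assoc)
  ultimately have "Arg ?c - M2 r \<alpha> \<le> \<phi>"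
    using c t r2 M2 by (intro argument_in_disc_ge[where t = "(1 - r\<^sup>2) * t"]) auto
  then have Re: "2 * ?s + M1 r \<alpha> - M2 r \<alpha> \<le> 2 * ?s * Re p"
    using M1 by (simp add: \<phi>_def algebra_simps)
  let ?D = "2 * ?s + M1 r \<alpha> - M2 r \<alpha>"
  have D: "0 < ?D" by (rule denominator_pos[OF assms(1,2) r])
  have sRe: "0 < 2 * ?s * Re p" using D Re by linarith
  then have Re_pos: "0 < Re p" using s by (simp add: zero_less_mult_iff)
  have "\<bar>Im p / Re p\<bar> = (2 * ?s * \<bar>Im p\<bar>) / (2 * ?s * Re p)" using s Re_pos by simp
  also have "\<dots> \<le> ln (N r \<alpha>) / ?D" using Im Re D s by (intro frac_le) (auto intro: order_trans[OF _ Im])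
  finally have "\<bar>Im p / Re p\<bar> \<le> ln (N r \<alpha>) / ?D" .
  then have "\<bar>arctan (Im p / Re p)\<bar> \<le> arctan (ln (N r \<alpha>) / ?D)"
    by (metis abs_le_iff arctan_minus arctan_monotone')
  then show "SS_condition \<gamma> f z"
    using root Re_pos by (simp add: SS_condition_def radius_equation_def arg_conv_arctan flip: p_def)
qed

theorem theorem6:
  fixes \<alpha> \<gamma> :: real
  assumes "pi / 2 \<le> \<alpha>" and "\<alpha> < pi" and "0 \<le> \<gamma>" and "\<gamma> < 1"
  shows "(0 < \<gamma> \<longrightarrow> (\<exists>r1. least_positive_root \<alpha> \<gamma> r1)) \<and>
    (\<forall>r1. least_positive_root \<alpha> \<gamma> r1 \<longrightarrow> MS_included_in_SS_on_disc \<alpha> \<gamma> r1)"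
  using exists_least_positive_root[OF assms(1,2) _ assms(4)] MS_included_of_root[OF assms(1,2)]
  by (auto simp: least_positive_root_def)

end
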